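(* Let $G$ be a non-trivial Polish divisible compact abelian group. Then for every pair of distinct non-zero integers $c_1,c_2$, we have $d_{(c_1,c_2)}(G)=1/2$.
   Context: For non-zero integers $c_1,c_2$ and a compact abelian group $G$ with Haar probability measure $\mu$ on the Borel $\sigma$-algebra $\mathcal{B}_G$, a set $A\in\mathcal{B}_G$ is called $(c_1,c_2)$-free if there are no solutions $(x_1,x_2)\in A^2$ to the equation $c_1x_1=c_2x_2$. Define $d_{(c_1,c_2)}(G)=\sup\{\mu(A): A\in\mathcal{B}_G \text{ is } (c_1,c_2)\text{-free}\}$. *)

theory Defs
  imports "HOL-Analysis.Analysis" "HOL-Probability.Probability"
begin

definition int_mult :: "int \<Rightarrow> 'a::ab_group_add \<Rightarrow> 'a" where
  "int_mult c x = (if c \<ge> 0 then (((+) x) ^^ nat c) 0 else - ((((+) x) ^^ nat (- c)) 0))"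

definition divisible_group :: "'a::ab_group_add itself \<Rightarrow> bool" where
  "divisible_group _ \<longleftrightarrow> (\<forall>n::nat. n \<ge> 1 \<longrightarrow> (\<forall>x::'a. \<exists>y. int_mult (int n) y = x))"

(* The regularity clause makes this the Haar probability measure on an arbitrary compact
   Hausdorff abelian group; on a Polish group it holds for every Borel probability measure. *)
definition haar_prob_measure :: "'a::{topological_ab_group_add, t2_space} measure \<Rightarrow> bool" where
  "haar_prob_measure \<mu> \<longleftrightarrow>
     prob_space \<mu> \<and> sets \<mu> = sets borel \<and>
     (\<forall>g. \<forall>A\<in>sets borel. emeasure \<mu> ((+) g ` A) = emeasure \<mu> A) \<and>
     (\<forall>A\<in>sets borel. emeasure \<mu> A = (SUP K\<in>{K. compact K \<and> K \<subseteq> A}. emeasure \<mu> K))"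

definition pair_free :: "int \<Rightarrow> int \<Rightarrow> 'a::ab_group_add set \<Rightarrow> bool" where
  "pair_free c1 c2 A \<longleftrightarrow> \<not> (\<exists>x1\<in>A. \<exists>x2\<in>A. int_mult c1 x1 = int_mult c2 x2)"

definition free_density ::
    "int \<Rightarrow> int \<Rightarrow> 'a::{topological_ab_group_add, t2_space} measure \<Rightarrow> real" where
  "free_density c1 c2 \<mu> = (SUP A\<in>{A\<in>sets borel. pair_free c1 c2 A}. measure \<mu> A)"

end

(* Multiplication by a nonzero integer is onto, hence preserves Haar measure; so for compact K
   inside a free set the disjoint images c1 K and c2 K each have at least the mass of K, which gives
   the upper bound 1/2.  For the lower bound with |c1| and |c2| distinct, a solution of c1 x1 = c2 x2
   shifts the sequence c1^(n-k) c2^k x, k = 0..n, by one step, so sorting points by the parity of the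
   time at which this sequence first enters a marker set B gives two free sets.  They cover all but
   little if B is small and yet hit by most sequences; a random union of tiny cells is such a B, as
   the terms of the sequence are almost surely distinct.  If c2 = -c1, comparing the labels of the
   cells of c1 x and -c1 x gives a free set. *)

theory Submission
  imports Defs
begin

section \<open>Integer multiples in an abelian group\<close>

lemma funpow_plus_add:
  "((+) x ^^ (m + n)) 0 = ((+) x ^^ m) 0 + ((+) (x::'a::ab_group_add) ^^ n) 0"
  by (induction m) (simp_all add: add.assoc)

text \<open>Writing an integer as a difference of two naturals removes the case split on the sign in
  \<open>int_mult\<close>, so additivity in the integer follows from
  \<open>funpow_plus_add\<close>.\<close>

lemma int_mult_int_diff:
  "int_mult (int m - int n) x = ((+) x ^^ m) 0 - ((+) x ^^ n) 0"
proof (cases "n \<le> m")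
  case True
  then obtain d where "m = n + d" by (auto simp: le_iff_add)
  then show ?thesis by (simp add: int_mult_def funpow_plus_add)
next
  case False
  then obtain d where "n = m + d" "d > 0" by (auto simp: not_le less_iff_Suc_add)
  then show ?thesis by (simp add: int_mult_def funpow_plus_add)
qed

lemma int_mult_0 [simp]: "int_mult 0 x = 0"
  by (simp add: int_mult_def)

lemma int_mult_1 [simp]: "int_mult 1 x = x"
  by (simp add: int_mult_def)

lemma int_mult_diff_left: "int_mult (a - b) x = int_mult a x - int_mult b x"
proof -
  obtain m n where a: "a = int m - int n" by (cases a rule: int_diff_cases)
  obtain k l where b: "b = int k - int l" by (cases b rule: int_diff_cases)
  have "a - b = int (m + l) - int (n + k)" using a b by simp
  then show ?thesis
    unfolding a b by (simp only: int_mult_int_diff funpow_plus_add) (simp add: algebra_simps)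
qed

lemma int_mult_minus_left: "int_mult (- a) x = - int_mult a x"
  using int_mult_diff_left[of 0 a x] by simp

lemma int_mult_add_left: "int_mult (a + b) x = int_mult a x + int_mult b x"
  using int_mult_diff_left[of a "- b" x] by (simp add: int_mult_minus_left)

lemma int_mult_add_right: "int_mult a (x + y) = int_mult a x + int_mult a y"
  by (induction a rule: int_induct[where k = 0])
    (simp_all add: int_mult_add_left int_mult_diff_left algebra_simps)

lemma int_mult_mult: "int_mult (a * b) x = int_mult a (int_mult b x)"
  by (induction a rule: int_induct[where k = 0])
    (simp_all add: int_mult_add_left int_mult_diff_left algebra_simps)

lemma continuous_on_int_mult:
  "continuous_on S (int_mult c :: 'a::topological_ab_group_add \<Rightarrow> 'a)"
proof -
  have "continuous_on S (\<lambda>x. int_mult c x :: 'a)"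
    by (induction c rule: int_induct[where k = 0])
      (simp_all add: int_mult_add_left int_mult_diff_left continuous_intros)
  then show ?thesis .
qed

lemma measurable_int_mult [measurable]:
  "(int_mult c :: 'a::topological_ab_group_add \<Rightarrow> 'a) \<in> borel_measurable borel"
  by (intro borel_measurable_continuous_onI continuous_on_int_mult)

text \<open>Divisibility speaks of positive integers; for negative \<open>c\<close>, divide
  \<open>- x\<close> by \<open>- c\<close>.\<close>

lemma divisible_group_int_mult_surj:
  assumes "divisible_group TYPE('a::ab_group_add)" "c \<noteq> 0"
  shows "\<exists>y. int_mult c y = (x::'a)"
proof -
  have pos: "\<exists>y. int_mult d y = z" if "d > 0" for d and z :: 'a
    using assms(1) that unfolding divisible_group_def by (metis int_one_le_iff_zero_less of_nat_1 of_nat_le_iff zero_less_imp_eq_int)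
  show ?thesis
  proof (cases "c > 0")
    case False
    then have "- c > 0" using assms(2) by simp
    from pos[OF this, of "- x"] show ?thesis by (auto simp: int_mult_minus_left)
  qed (use pos in blast)
qed

section \<open>Colourings, fine partitions and random markers\<close>

text \<open>Coordinates in \<open>I\<close> range over \<open>S\<close> and the others freely over
  \<open>Q\<close>. The extra factor \<open>card Q ^ card I\<close> avoids a subtraction in the
  exponent.\<close>

lemma card_PiE_constrained:
  assumes "finite J" "I \<subseteq> J" "S \<subseteq> Q"
  shows "card {c \<in> PiE J (\<lambda>_. Q). \<forall>i\<in>I. c i \<in> S} * card Q ^ card I = card S ^ card I * card Q ^ card J"
proof -
  have "{c \<in> PiE J (\<lambda>_. Q). \<forall>i\<in>I. c i \<in> S} = PiE J (\<lambda>i. if i \<in> I then S else Q)"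
    using assms(2,3) unfolding PiE_iff set_eq_iff mem_Collect_eq
    by (metis (no_types, lifting) subsetD)
  moreover have "card (PiE J (\<lambda>i. if i \<in> I then S else Q)) = card S ^ card I * card Q ^ card (J - I)"
    using assms(1,2) by (simp add: card_PiE prod.If_cases if_distrib Int_absorb1 Diff_eq)
  moreover have "card J = card (J - I) + card I"
    using assms(1,2) by (metis card_Diff_subset card_mono finite_subset le_add_diff_inverse2)
  ultimately show ?thesis by (simp add: power_add)
qed

text \<open>By total boundedness finitely many balls of radius \<open>\<delta> / 2\<close> cover the
  space. Labelling a point with the first ball that contains it makes the overlapping balls into
  disjoint Borel cells.\<close>

lemma fine_labelling:
  assumes "compact (UNIV :: 'b::{metric_space, second_countable_topology} set)" "\<delta> > 0"
  shows "\<exists>(lab :: 'b \<Rightarrow> nat) m. lab \<in> borel \<rightarrow>\<^sub>M count_space UNIV \<and> (\<forall>y. lab y < m) \<and>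
    (\<forall>y z. lab y = lab z \<longrightarrow> dist y z < \<delta>)"
proof -
  obtain F where F: "finite F" "(UNIV :: 'b set) \<subseteq> (\<Union>x\<in>F. ball x (\<delta> / 2))"
    using assms compact_imp_seq_compact seq_compact_imp_totally_bounded
    by (metis half_gt_zero_iff)
  from finite_list[OF F(1)] obtain xs where xs: "set xs = F" by blast
  define lab where "lab y = (LEAST i. i < length xs \<and> dist (xs ! i) y < \<delta> / 2)" for y
  have ex: "\<exists>i. i < length xs \<and> dist (xs ! i) y < \<delta> / 2" for y
    using F(2) xs by (fastforce simp: in_set_conv_nth)
  have lab: "lab y < length xs" "dist (xs ! lab y) y < \<delta> / 2" for y
    using LeastI_ex[OF ex[of y]] by (auto simp: lab_def)
  show ?thesis
  proof (intro exI conjI allI impI)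
    show "lab \<in> borel \<rightarrow>\<^sub>M count_space UNIV"
      unfolding lab_def by measurable
    show "lab y < length xs" for y by (rule lab)
    show "dist y z < \<delta>" if "lab y = lab z" for y z
      using lab(2)[of y] lab(2)[of z] dist_triangle3[of y z "xs ! lab y"] that by simp
  qed
qed

text \<open>The events of a collision up to distance \<open>1 / Suc i\<close> decrease, and their
  intersection lies in the null event of an exact coincidence; continuity from above then gives a
  small one.\<close>

lemma (in prob_space) small_near_collision:
  fixes f :: "nat \<Rightarrow> 'a \<Rightarrow> 'b::{metric_space, second_countable_topology}"
  assumes meas [measurable]: "\<And>k. f k \<in> borel_measurable M"
    and null: "\<And>j k. j < k \<Longrightarrow> k \<le> n \<Longrightarrow> AE x in M. f j x \<noteq> f k x"
    and "\<epsilon> > 0"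
  obtains \<delta> where "\<delta> > 0" "prob {x\<in>space M. \<exists>k\<le>n. \<exists>j<k. dist (f j x) (f k x) < \<delta>} < \<epsilon>"
proof -
  define U where "U i = {x\<in>space M. \<exists>k\<le>n. \<exists>j<k. dist (f j x) (f k x) < 1 / real (Suc i)}" for i
  have [measurable]: "U i \<in> sets M" for i unfolding U_def by measurable
  have "decseq U"
    unfolding U_def by (rule decseq_SucI) (fastforce simp: frac_less2 intro: less_trans)
  have "AE x in M. \<forall>k\<in>{..n}. \<forall>j\<in>{..<k}. f j x \<noteq> f k x"
    using null by (simp add: AE_finite_all)
  \<comment> \<open>Only finitely many pairs are involved, so without a coincidence their distances
    would have a common positive lower bound.\<close>
  moreover have "\<exists>k\<le>n. \<exists>j<k. f j x = f k x" if x: "x \<in> (\<Inter>i. U i)" for x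
  proof (rule ccontr)
    assume "\<not> ?thesis"
    then have pos: "dist (f j x) (f k x) > 0" if "k \<le> n" "j < k" for j k using that by auto
    define D where "D = (\<lambda>(k, j). dist (f j x) (f k x)) ` (SIGMA k:{..n}. {..<k})"
    have fin: "finite D" unfolding D_def by auto
    have posD: "\<forall>d\<in>D. d > 0" unfolding D_def using pos by auto
    \<comment> \<open>Induction covers the case \<open>n = 0\<close>, where \<open>D\<close> is
      empty and has no minimum.\<close>
    have "\<exists>e>0. \<forall>d\<in>D. e < d"
      using fin posD
    proof (induction rule: finite_induct)
      case (insert d D)
      then obtain e where "e > 0" "\<forall>d\<in>D. e < d" by auto
      then show ?case using insert.prems
        by (intro exI[of _ "min e (d / 2)"]) auto
    qed (auto intro: exI[of _ 1])
    then obtain e where e: "e > 0" "\<And>d. d \<in> D \<Longrightarrow> e < d" by blast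
    from reals_Archimedean[OF e(1)] obtain i where i: "inverse (real (Suc i)) < e" by blast
    from x have "x \<in> U i" by blast
    then obtain k j where "k \<le> n" "j < k" "dist (f j x) (f k x) < 1 / real (Suc i)"
      unfolding U_def by blast
    moreover from this have "dist (f j x) (f k x) \<in> D" unfolding D_def by force
    ultimately show False using e(2) i by (force simp: inverse_eq_divide)
  qed
  ultimately have "AE x in M. x \<notin> (\<Inter>i. U i)"
    by (elim AE_mp) (intro AE_I2, fastforce)
  then have "prob (\<Inter>i. U i) = 0" by (intro prob_eq_0[THEN iffD2]) auto
  moreover have "(\<lambda>i. prob (U i)) \<longlonglongrightarrow> prob (\<Inter>i. U i)"
    by (rule finite_Lim_measure_decseq) (use \<open>decseq U\<close> in auto)
  ultimately have "\<forall>\<^sub>F i in sequentially. prob (U i) < \<epsilon>"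
    using \<open>\<epsilon> > 0\<close> by (simp add: order_tendstoD)
  then obtain i where "prob (U i) < \<epsilon>" by (auto simp: eventually_sequentially)
  then show ?thesis using that[of "1 / real (Suc i)"] unfolding U_def by simp
qed

text \<open>The marker is a union of cells of a fine partition chosen by a colouring of the cells with
  \<open>q\<close> colours; the bound is the average over all colourings.\<close>

lemma (in prob_space) exists_marker:
  fixes f :: "nat \<Rightarrow> 'a \<Rightarrow> 'b::{metric_space, second_countable_topology}"
  assumes compact: "compact (UNIV :: 'b set)"
    and meas [measurable]: "\<And>k. f k \<in> borel_measurable M"
    and null: "\<And>j k. j < k \<Longrightarrow> k \<le> n \<Longrightarrow> AE x in M. f j x \<noteq> f k x"
    and "\<epsilon> > 0" and q: "q > 0"
  obtains B where "B \<in> sets borel"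
    "prob {x\<in>space M. f 0 x \<in> B \<or> (\<forall>k\<le>n. f k x \<notin> B)} \<le> 1 / real q + (1 - 1 / real q) ^ Suc n + \<epsilon>"
proof -
  obtain \<delta> where "\<delta> > 0" and
    small: "prob {x\<in>space M. \<exists>k\<le>n. \<exists>j<k. dist (f j x) (f k x) < \<delta>} < \<epsilon>" (is "prob ?U < _")
    by (rule small_near_collision[OF meas null \<open>\<epsilon> > 0\<close>])
  obtain lab :: "'b \<Rightarrow> nat" and m where [measurable]: "lab \<in> borel \<rightarrow>\<^sub>M count_space UNIV"
    and lab: "\<And>y. lab y < m" "\<And>y z. lab y = lab z \<Longrightarrow> dist y z < \<delta>"
    using fine_labelling[OF compact \<open>\<delta> > 0\<close>] by metis
  define C where "C = PiE {..<m} (\<lambda>_. {..<q})"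
  have finC: "finite C" unfolding C_def by (intro finite_PiE) auto
  have cardC: "card C = q ^ m" unfolding C_def by (simp add: card_PiE)
  \<comment> \<open>Colour \<open>0\<close> selects the cells of the marker, so \<open>L c\<close>
    is the failure event of the colouring \<open>c\<close>.\<close>
  define L where "L c = {x\<in>space M. c (lab (f 0 x)) = 0 \<or> (\<forall>k\<le>n. c (lab (f k x)) \<noteq> 0)}"
    for c :: "nat \<Rightarrow> nat"
  have [measurable]: "L c \<in> sets M" for c
    unfolding L_def by measurable
  have q1: "real q - 1 = real (q - 1)" using q by simp
  have lt: "c (lab y) < q" if "c \<in> C" for c y
    using that lab(1) unfolding C_def by (auto dest: PiE_mem)
  let ?t = "1 / real q + (1 - 1 / real q) ^ Suc n"
  have t0: "?t \<ge> 0" using q by simp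
  \<comment> \<open>Off \<open>?U\<close> the \<open>n + 1\<close> terms lie in distinct cells,
    whose colours are independent: the first is \<open>0\<close> for a proportion
    \<open>1 / q\<close> of colourings, and all are nonzero for a proportion
    \<open>(1 - 1 / q) ^ Suc n\<close>. On \<open>?U\<close> the trivial bound by all colourings is
    enough.\<close>
  have pointwise: "(\<Sum>c\<in>C. indicator (L c) x) \<le> real q ^ m * (?t + indicator ?U x)"
    if x: "x \<in> space M" for x
  proof -
    have eq: "(\<Sum>c\<in>C. indicator (L c) x) = real (card {c\<in>C. x \<in> L c})"
      using finC by (simp add: indicator_def sum.If_cases Int_def)
    show ?thesis
    proof (cases "x \<in> ?U")
      case True
      have "real (card {c\<in>C. x \<in> L c}) \<le> real q ^ m"
        using card_mono[OF finC, of "{c\<in>C. x \<in> L c}"] cardC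
        by (metis (no_types, lifting) mem_Collect_eq of_nat_le_iff of_nat_power subsetI)
      also have "\<dots> \<le> real q ^ m * (?t + indicator ?U x)"
        using mult_left_mono[of 1 "?t + indicator ?U x" "real q ^ m"] True t0 by simp
      finally show ?thesis using eq by simp
    next
      case False
      let ?I = "(\<lambda>k. lab (f k x)) ` {..n}"
      have "inj_on (\<lambda>k. lab (f k x)) {..n}"
      proof (rule linorder_inj_onI')
        fix j k assume "j < k" "j \<in> {..n}" "k \<in> {..n}"
        then show "lab (f j x) \<noteq> lab (f k x)" using False x lab(2) by blast
      qed
      then have cI: "card ?I = Suc n" by (simp add: card_image)
      have "card {c\<in>C. \<forall>i\<in>{lab (f 0 x)}. c i \<in> {0}} * q = q ^ m"
        using card_PiE_constrained[of "{..<m}" "{lab (f 0 x)}" "{0}" "{..<q}"] lab(1) q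
        unfolding C_def by simp
      then have 1: "real (card {c\<in>C. c (lab (f 0 x)) = 0}) = real q ^ m * (1 / real q)"
        using q by (simp add: field_simps flip: of_nat_power of_nat_mult)
      have "card {c\<in>C. \<forall>i\<in>?I. c i \<in> {1..<q}} * q ^ Suc n = (q - 1) ^ Suc n * q ^ m"
        unfolding C_def
        using card_PiE_constrained[of "{..<m}" ?I "{1..<q}" "{..<q}"] lab(1) cI
        by (simp only: finite_lessThan image_subset_iff lessThan_iff card_atLeastLessThan
            card_lessThan ivl_subset lessThan_atLeast0) simp
      then have "real (card {c\<in>C. \<forall>i\<in>?I. c i \<in> {1..<q}}) * real q ^ Suc n
          = (real q - 1) ^ Suc n * real q ^ m"
        unfolding q1 of_nat_power[symmetric] of_nat_mult[symmetric] by (rule arg_cong)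
      then have "real (card {c\<in>C. \<forall>i\<in>?I. c i \<in> {1..<q}})
          = real q ^ m * ((real q - 1) / real q) ^ Suc n"
        using q by (simp add: power_divide nonzero_eq_divide_eq mult.commute del: power_Suc)
      also have "(real q - 1) / real q = 1 - 1 / real q" using q by (simp add: field_simps)
      also have "{c\<in>C. \<forall>i\<in>?I. c i \<in> {1..<q}} = {c\<in>C. \<forall>k\<le>n. c (lab (f k x)) \<noteq> 0}"
        using lt by (auto simp: Suc_le_eq)
      finally have 2: "real (card {c\<in>C. \<forall>k\<le>n. c (lab (f k x)) \<noteq> 0})
          = real q ^ m * (1 - 1 / real q) ^ Suc n" .
      have "{c\<in>C. x \<in> L c} \<subseteq>
          {c\<in>C. c (lab (f 0 x)) = 0} \<union> {c\<in>C. \<forall>k\<le>n. c (lab (f k x)) \<noteq> 0}"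
        unfolding L_def by auto
      then have "card {c\<in>C. x \<in> L c} \<le>
          card ({c\<in>C. c (lab (f 0 x)) = 0} \<union> {c\<in>C. \<forall>k\<le>n. c (lab (f k x)) \<noteq> 0})"
        using finC by (intro card_mono) simp_all
      also have "\<dots> \<le> card {c\<in>C. c (lab (f 0 x)) = 0} + card {c\<in>C. \<forall>k\<le>n. c (lab (f k x)) \<noteq> 0}"
        by (rule card_Un_le)
      finally have "real (card {c\<in>C. x \<in> L c}) \<le> real (card {c\<in>C. c (lab (f 0 x)) = 0})
          + real (card {c\<in>C. \<forall>k\<le>n. c (lab (f k x)) \<noteq> 0})" by linarith
      then have "real (card {c\<in>C. x \<in> L c}) \<le> real q ^ m * ?t"
        unfolding 1 2 by (simp only: distrib_left)
      then show ?thesis using eq False by simp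
    qed
  qed
  have [measurable]: "?U \<in> sets M" by measurable
  have int: "integrable M (indicator S :: 'a \<Rightarrow> real)" if "S \<in> sets M" for S
    using that by (simp add: emeasure_eq_measure)
  have "(\<Sum>c\<in>C. prob (L c)) = expectation (\<lambda>x. \<Sum>c\<in>C. indicator (L c) x)"
    using int by (simp add: Bochner_Integration.integral_sum)
  also have "\<dots> \<le> expectation (\<lambda>x. real q ^ m * (?t + indicator ?U x))"
    using pointwise int by (intro integral_mono) auto
  also have "\<dots> = real q ^ m * (?t + prob ?U)"
    using int[of ?U] by (simp add: prob_space del: power_Suc)
  also have "\<dots> \<le> (\<Sum>c\<in>C. ?t + \<epsilon>)" using small cardC q by simp
  finally have "(\<Sum>c\<in>C. prob (L c)) \<le> (\<Sum>c\<in>C. ?t + \<epsilon>)" .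
  moreover have "C \<noteq> {}" using cardC q by auto
  \<comment> \<open>Some colouring does no worse than the average.\<close>
  ultimately obtain c where c: "prob (L c) \<le> ?t + \<epsilon>"
    using finC by (metis (no_types, lifting) linorder_not_le sum_strict_mono)
  show ?thesis
  proof (rule that[of "{y. c (lab y) = 0}"])
    show "{y. c (lab y) = 0} \<in> sets borel" by measurable
  qed (use c in \<open>simp add: L_def\<close>)
qed

section \<open>Haar measure and the multiplication maps\<close>

text \<open>Compute the product measure of the pairs with sum in \<open>A\<close> in both orders: by
  invariance every section in one direction has mass \<open>N A\<close>, and in the other, using
  commutativity, mass \<open>M A\<close>.\<close>

lemma invariant_prob_unique:
  fixes M N :: "'a::{topological_ab_group_add, second_countable_topology} measure"
  assumes M: "prob_space M" "sets M = sets borel"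
      "\<And>g A. A \<in> sets borel \<Longrightarrow> emeasure M {x. g + x \<in> A} = emeasure M A"
    and N: "prob_space N" "sets N = sets borel"
      "\<And>g A. A \<in> sets borel \<Longrightarrow> emeasure N {x. g + x \<in> A} = emeasure N A"
  shows "M = N"
proof (rule measure_eqI)
  interpret M: prob_space M by fact
  interpret N: prob_space N by fact
  interpret pair_prob_space M N ..
  have [measurable_cong]: "sets M = sets borel" "sets N = sets borel" by fact+
  have sp: "space M = UNIV" "space N = UNIV"
    using M(2) N(2) by (metis sets_eq_imp_space_eq space_borel)+
  fix A assume "A \<in> sets M"
  then have A [measurable]: "A \<in> sets borel" using M(2) by simp
  let ?S = "{p. fst p + snd p \<in> A}"
  have "?S = (\<lambda>p. fst p + snd p) -` A \<inter> space (M \<Otimes>\<^sub>M N)"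
    by (auto simp: space_pair_measure sp)
  also have "\<dots> \<in> sets (M \<Otimes>\<^sub>M N)" by measurable
  finally have S: "?S \<in> sets (M \<Otimes>\<^sub>M N)" .
  have "emeasure N A = (\<integral>\<^sup>+x. emeasure N (Pair x -` ?S) \<partial>M)"
    using N(3)[OF A] by (simp add: vimage_def M.emeasure_space_1)
  also have "\<dots> = emeasure (M \<Otimes>\<^sub>M N) ?S"
    by (rule N.emeasure_pair_measure_alt[OF S, symmetric])
  also have "\<dots> = (\<integral>\<^sup>+y. emeasure M ((\<lambda>x. (x, y)) -` ?S) \<partial>N)"
    by (rule emeasure_pair_measure_alt2[OF S])
  also have "\<dots> = emeasure M A"
    using M(3)[OF A] by (simp add: vimage_def add.commute N.emeasure_space_1)
  finally show "emeasure M A = emeasure N A" by simp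
qed (simp add: M(2) N(2))

locale divisible_haar = prob_space \<mu>
  for \<mu> :: "'a::{topological_ab_group_add, polish_space} measure" +
  assumes compact_UNIV: "compact (UNIV :: 'a set)"
    and nontrivial: "\<exists>x::'a. x \<noteq> 0"
    and divisible: "divisible_group TYPE('a)"
    and haar: "haar_prob_measure \<mu>"
begin

lemma sets_haar [measurable_cong, simp]: "sets \<mu> = sets borel"
  using haar by (simp add: haar_prob_measure_def)

lemma space_haar [simp]: "space \<mu> = UNIV"
  using sets_eq_imp_space_eq[OF sets_haar] by simp

lemma emeasure_translate:
  assumes "A \<in> sets borel"
  shows "emeasure \<mu> {x. g + x \<in> A} = emeasure \<mu> A"
proof -
  have "{x. g + x \<in> A} = (+) (- g) ` A"
    by (force simp: image_iff algebra_simps)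
  moreover have "emeasure \<mu> ((+) (- g) ` A) = emeasure \<mu> A"
    using haar assms unfolding haar_prob_measure_def by blast
  ultimately show ?thesis by argo
qed

text \<open>Each \<open>g\<close> is \<open>int_mult c h\<close> for some \<open>h\<close>, so
  translating the image measure by \<open>g\<close> amounts to translating \<open>\<mu>\<close> by
  \<open>h\<close>. The image measure is thus invariant, and uniqueness applies.\<close>

lemma distr_int_mult:
  assumes "c \<noteq> 0"
  shows "distr \<mu> borel (int_mult c) = \<mu>"
proof (rule invariant_prob_unique)
  show "prob_space (distr \<mu> borel (int_mult c))"
    by (rule prob_space_distr) measurable
  fix g :: 'a and A :: "'a set" assume A [measurable]: "A \<in> sets borel"
  obtain h where h: "g = int_mult c h"
    using divisible_group_int_mult_surj[OF divisible assms, of g] by metis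
  have "emeasure (distr \<mu> borel (int_mult c)) {x. g + x \<in> A}
      = emeasure \<mu> {x. h + x \<in> {z. int_mult c z \<in> A}}"
    by (subst emeasure_distr) (simp_all add: h int_mult_add_right vimage_def)
  also have "\<dots> = emeasure \<mu> {z. int_mult c z \<in> A}"
    by (rule emeasure_translate) measurable
  also have "\<dots> = emeasure (distr \<mu> borel (int_mult c)) A"
    by (subst emeasure_distr) (simp_all add: vimage_def)
  finally show "emeasure (distr \<mu> borel (int_mult c)) {x. g + x \<in> A}
      = emeasure (distr \<mu> borel (int_mult c)) A" .
qed (simp_all add: emeasure_translate prob_space_axioms)

lemma prob_int_mult:
  assumes "c \<noteq> 0" and [measurable]: "B \<in> sets borel"
  shows "prob {x. int_mult c x \<in> B} = prob B"
  using measure_distr[of "int_mult c" \<mu> borel B] distr_int_mult[OF assms(1)]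
  by (simp add: vimage_def)

text \<open>If \<open>0\<close> had positive mass then so would every point, and the kernels of multiplication, having
  the mass of \<open>0\<close>, would be trivial; the multiples of a nonzero element would then be infinitely
  many points of equal mass.\<close>

lemma prob_zero: "prob {0} = 0"
proof (rule ccontr)
  assume "prob {0} \<noteq> 0"
  then have pos: "prob {0} > 0" by (simp add: measure_nonneg order_less_le)
  have pt: "prob {a} = prob {0}" for a
    using emeasure_translate[of "{a}" a] by (simp add: measure_def)
  obtain x :: 'a where x: "x \<noteq> 0" using nontrivial by blast
  have inj: "int_mult c x \<noteq> 0" if "c \<noteq> 0" for c
  proof
    assume "int_mult c x = 0"
    \<comment> \<open>Additivity at \<open>0 + 0\<close> yields \<open>int_mult c 0 = 0\<close>, so
      both points lie in the kernel.\<close>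
    then have "prob {0, x} \<le> prob {y. int_mult c y \<in> {0}}"
      using int_mult_add_right[of c 0 0] by (intro finite_measure_mono) auto
    also have "\<dots> = prob {0}" using that by (rule prob_int_mult) simp
    also have "prob {0, x} = prob {0} + prob {x}"
      using x by (subst finite_measure_eq_sum_singleton) auto
    finally show False using pos pt[of x] by simp
  qed
  have "real n * prob {0} \<le> 1" for n
  proof -
    let ?F = "(\<lambda>k. int_mult (int k) x) ` {..<n}"
    have "inj_on (\<lambda>k. int_mult (int k) x) {..<n}"
      using inj by (intro inj_onI) (metis int_mult_diff_left eq_iff_diff_eq_0 of_nat_eq_iff)
    then have "real n * prob {0} = (\<Sum>a\<in>?F. prob {a})"
      by (subst sum.cong[OF refl pt]) (simp add: card_image)
    also have "\<dots> = prob ?F"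
      by (rule finite_measure_eq_sum_singleton[symmetric]) auto
    finally show ?thesis by simp
  qed
  then show False using pos by (metis ex_less_of_nat_mult linorder_not_le)
qed

lemma AE_int_mult_nonzero:
  assumes "c \<noteq> 0"
  shows "AE x in \<mu>. int_mult c x \<noteq> 0"
proof -
  have "prob {x. int_mult c x \<in> {0}} = 0"
    using prob_int_mult[OF assms, of "{0}"] prob_zero by simp
  then show ?thesis
    by (subst (asm) prob_eq_0) (auto elim: AE_mp)
qed

text \<open>Two multiples agree exactly on the kernel of multiplication by \<open>c - d\<close>, a
  null set. This gives the almost sure distinctness that both lower bound constructions rely
  on.\<close>

lemma AE_int_mult_neq:
  assumes "c \<noteq> d"
  shows "AE x in \<mu>. int_mult c x \<noteq> int_mult d x"
  using AE_int_mult_nonzero[of "c - d"] assms by (simp add: int_mult_diff_left)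

section \<open>The upper bound\<close>

lemma pair_free_prob_le_half:
  assumes "c1 \<noteq> 0" "c2 \<noteq> 0" and A: "A \<in> sets borel" "pair_free c1 c2 A"
  shows "prob A \<le> 1 / 2"
proof -
  have "emeasure \<mu> K \<le> ennreal (1 / 2)" if K: "compact K" "K \<subseteq> A" for K
  proof -
    have [measurable]: "K \<in> sets borel" using K(1) by (simp add: borel_closed compact_imp_closed)
    have cK [measurable]: "int_mult c ` K \<in> sets borel" for c
      using K(1) by (intro borel_closed compact_imp_closed compact_continuous_image
          continuous_on_int_mult)
    have le: "prob K \<le> prob (int_mult c ` K)" if "c \<noteq> 0" for c
    proof -
      have "prob K \<le> prob {x. int_mult c x \<in> int_mult c ` K}"
        by (intro finite_measure_mono) auto
      then show ?thesis using prob_int_mult[OF that cK] by simp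
    qed
    have "int_mult c1 ` K \<inter> int_mult c2 ` K = {}"
      using A(2) K(2) unfolding pair_free_def by blast
    then have "prob (int_mult c1 ` K) + prob (int_mult c2 ` K)
        = prob (int_mult c1 ` K \<union> int_mult c2 ` K)"
      by (subst finite_measure_Union) auto
    then have "2 * prob K \<le> 1"
      using le[OF assms(1)] le[OF assms(2)] prob_le_1[of "int_mult c1 ` K \<union> int_mult c2 ` K"]
      by linarith
    then show ?thesis unfolding emeasure_eq_measure by (intro ennreal_leI) simp
  qed
  moreover have "emeasure \<mu> A = (SUP K\<in>{K. compact K \<and> K \<subseteq> A}. emeasure \<mu> K)"
    using haar A(1) by (simp add: haar_prob_measure_def)
  ultimately have "emeasure \<mu> A \<le> ennreal (1 / 2)" by (auto intro!: SUP_least)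
  then show ?thesis unfolding emeasure_eq_measure by (subst (asm) ennreal_le_iff) simp_all
qed

section \<open>The lower bound\<close>

text \<open>Here the sequence of the marker construction would take at most two values. Instead, a
  solution of \<open>c x1 = - c x2\<close> swaps the two labels being compared, so a strict
  inequality cannot hold at both points.\<close>

lemma pair_free_opposite:
  assumes "c \<noteq> 0" "\<epsilon> > 0"
  shows "\<exists>A\<in>sets borel. pair_free c (- c) A \<and> prob A \<ge> 1 / 2 - \<epsilon>"
proof -
  \<comment> \<open>The two maps form a sequence of length two, to be used with
    \<open>small_near_collision\<close> at \<open>n = 1\<close>.\<close>
  define f where "f k = (int_mult (if k = 0 then c else - c) :: 'a \<Rightarrow> 'a)" for k :: nat
  have f [measurable]: "f k \<in> borel_measurable \<mu>" for k unfolding f_def by measurable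
  have "AE x in \<mu>. f j x \<noteq> f k x" if "j < k" "k \<le> 1" for j k
    using AE_int_mult_neq[of c "- c"] that assms(1) unfolding f_def by auto
  from small_near_collision[of f 1, OF f this assms(2)] obtain \<delta> where "\<delta> > 0" and
    \<delta>: "prob {x\<in>space \<mu>. \<exists>k\<le>1. \<exists>j<k. dist (f j x) (f k x) < \<delta>} < \<epsilon>" by blast
  obtain lab :: "'a \<Rightarrow> nat" and m where lab_meas: "lab \<in> borel \<rightarrow>\<^sub>M count_space UNIV"
    and lab: "\<And>y. lab y < m" "\<And>y z. lab y = lab z \<Longrightarrow> dist y z < \<delta>"
    using fine_labelling[OF compact_UNIV \<open>\<delta> > 0\<close>] by metis
  have [measurable]: "lab \<in> borel_measurable borel"
    by (rule measurable_compose[OF lab_meas]) simp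
  define A where "A d = {x. lab (int_mult d x) < lab (int_mult (- d) x)}" for d
  have A [measurable]: "A d \<in> sets borel" for d unfolding A_def by measurable
  \<comment> \<open>Negation preserves \<open>\<mu>\<close> and carries one strict comparison to the
    other; ties force a near collision, so each set has nearly half the mass.\<close>
  have "prob (A (- c)) = prob {x. int_mult (- 1) x \<in> A c}"
    by (simp add: A_def flip: int_mult_mult)
  also have "\<dots> = prob (A c)" by (rule prob_int_mult) simp_all
  finally have sym: "prob (A (- c)) = prob (A c)" .
  have "UNIV \<subseteq> A c \<union> A (- c) \<union> {x\<in>space \<mu>. \<exists>k\<le>1. \<exists>j<k. dist (f j x) (f k x) < \<delta>}"
    (is "_ \<subseteq> _ \<union> ?U")
  proof
    fix x
    consider "x \<in> A c" | "x \<in> A (- c)" | "lab (int_mult c x) = lab (int_mult (- c) x)"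
      unfolding A_def by fastforce
    then show "x \<in> A c \<union> A (- c) \<union> ?U"
    proof cases
      case 3
      then have "dist (f 0 x) (f 1 x) < \<delta>" unfolding f_def by (simp add: lab(2))
      then show ?thesis by auto
    qed auto
  qed
  then have "prob UNIV \<le> prob (A c \<union> A (- c) \<union> ?U)"
    by (intro finite_measure_mono) simp_all
  also have "\<dots> \<le> prob (A c) + prob (A (- c)) + prob ?U"
    by (intro order_trans[OF measure_Un_le] add_right_mono
        measure_Un_le) simp_all
  finally have "prob (A c) \<ge> 1 / 2 - \<epsilon>"
    using \<delta> sym assms(2) prob_space by simp
  moreover have "pair_free c (- c) (A c)"
    unfolding pair_free_def A_def by (auto simp: int_mult_minus_left)
  ultimately show ?thesis using A by blast
qed

lemma pair_free_generic:
  assumes c: "c1 \<noteq> 0" "c2 \<noteq> 0" "\<bar>c1\<bar> \<noteq> \<bar>c2\<bar>" and "\<epsilon> > 0"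
  shows "\<exists>A\<in>sets borel. pair_free c1 c2 A \<and> prob A \<ge> 1 / 2 - \<epsilon>"
proof -
  \<comment> \<open>A large \<open>q\<close> makes the marker rare; a larger \<open>n\<close> then
    makes it unlikely to be missed. With the \<open>\<epsilon>\<close> of
    \<open>exists_marker\<close> the total loss is at most \<open>2 * \<epsilon>\<close>, and the
    larger of two sets loses at most half of that.\<close>
  obtain q0 where q0: "1 / real (Suc q0) < \<epsilon> / 2"
    using reals_Archimedean[of "\<epsilon> / 2"] \<open>\<epsilon> > 0\<close> by (auto simp: inverse_eq_divide)
  define q where "q = Suc q0"
  have q: "q > 0" "1 / real q < \<epsilon> / 2" using q0 by (auto simp: q_def)
  have "(\<lambda>n. (1 - 1 / real q) ^ n) \<longlonglongrightarrow> 0"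
    using q by (intro LIMSEQ_realpow_zero) auto
  then have "\<forall>\<^sub>F n in sequentially. (1 - 1 / real q) ^ n < \<epsilon> / 2"
    using \<open>\<epsilon> > 0\<close> by (intro order_tendstoD(2)[of _ 0]) simp_all
  then obtain n where n: "(1 - 1 / real q) ^ Suc n < \<epsilon> / 2"
    by (auto simp: eventually_sequentially intro: le_SucI)
  define f where "f k = (int_mult (c1 ^ (n - k) * c2 ^ k) :: 'a \<Rightarrow> 'a)" for k
  have f [measurable]: "f k \<in> borel_measurable \<mu>" for k unfolding f_def by measurable
  have null: "AE x in \<mu>. f j x \<noteq> f k x" if "j < k" "k \<le> n" for j k
  proof -
    from that obtain d e where "d > 0" and k: "k = j + d" and n: "n = j + d + e"
      by (metis le_Suc_ex less_imp_add_positive)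
    \<comment> \<open>The last factor is nonzero because \<open>c1\<close> and \<open>c2\<close>
      differ in absolute value and \<open>d > 0\<close>.\<close>
    have "c1 ^ (n - j) * c2 ^ j - c1 ^ (n - k) * c2 ^ k = c1 ^ e * c2 ^ j * (c1 ^ d - c2 ^ d)"
      unfolding k n by (simp add: power_add algebra_simps)
    moreover have "c1 ^ d \<noteq> c2 ^ d"
      using c(3) \<open>d > 0\<close> by (metis abs_ge_zero power_abs power_eq_imp_eq_base)
    ultimately have "c1 ^ (n - j) * c2 ^ j \<noteq> c1 ^ (n - k) * c2 ^ k"
      using c(1,2) by (metis diff_self divisors_zero eq_iff_diff_eq_0 power_not_zero)
    then show ?thesis unfolding f_def by (rule AE_int_mult_neq)
  qed
  obtain B where [measurable]: "B \<in> sets borel" and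
    B: "prob {x\<in>space \<mu>. f 0 x \<in> B \<or> (\<forall>k\<le>n. f k x \<notin> B)}
        \<le> 1 / real q + (1 - 1 / real q) ^ Suc n + \<epsilon>" (is "prob ?L \<le> _")
    by (rule exists_marker[OF compact_UNIV f null \<open>\<epsilon> > 0\<close> q(1)])
  \<comment> \<open>Points are sorted by the parity of their first entry time into \<open>B\<close>.
    Time \<open>0\<close> is excluded so that the entry of \<open>x2\<close> always has a preceding
    index at which to look at \<open>x1\<close>.\<close>
  define A where
    "A e = {x. \<exists>k\<in>{1..n}. even k = e \<and> f k x \<in> B \<and> (\<forall>j<k. f j x \<notin> B)}" for e
  have A [measurable]: "A e \<in> sets borel" for e unfolding A_def by measurable
  have free: "pair_free c1 c2 (A e)" for e
    unfolding pair_free_def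
  proof (intro notI, elim bexE)
    fix x1 x2 assume "x1 \<in> A e" "x2 \<in> A e" and eq: "int_mult c1 x1 = int_mult c2 x2"
    \<comment> \<open>Multiply the common value \<open>c1 x1 = c2 x2\<close> by
      \<open>c1 ^ (n - Suc k) * c2 ^ k\<close>.\<close>
    have shift: "f (Suc k) x2 = f k x1" if "Suc k \<le> n" for k
    proof -
      have "n - k = Suc (n - Suc k)" using that by simp
      then have "f (Suc k) x2 = int_mult (c1 ^ (n - Suc k) * c2 ^ k) (int_mult c2 x2)"
        "f k x1 = int_mult (c1 ^ (n - Suc k) * c2 ^ k) (int_mult c1 x1)"
        unfolding f_def by (simp_all add: mult_ac flip: int_mult_mult)
      then show ?thesis using eq by simp
    qed
    obtain k1 where k1: "k1 \<in> {1..n}" "even k1 = e" "f k1 x1 \<in> B" "\<forall>j<k1. f j x1 \<notin> B"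
      using \<open>x1 \<in> A e\<close> unfolding A_def by blast
    obtain k where k: "Suc k \<in> {1..n}" "even (Suc k) = e" "f (Suc k) x2 \<in> B"
        "\<forall>j<Suc k. f j x2 \<notin> B"
      using \<open>x2 \<in> A e\<close> unfolding A_def by (auto simp: Suc_le_eq gr0_conv_Suc)
    have "f k x1 \<in> B" using k shift by simp
    moreover have "f j x1 \<notin> B" if "j < k" for j
      using k shift[of j] that by (metis Suc_leI Suc_less_eq atLeastAtMost_iff less_imp_le order_trans)
    \<comment> \<open>First entry times are unique, so \<open>x1\<close> enters exactly one step
      before \<open>x2\<close>, with the opposite parity.\<close>
    ultimately have "k1 = k" using k1 by (meson linorder_neqE_nat)
    then show False using k1(2) k(2) by simp
  qed
  have "UNIV \<subseteq> A True \<union> A False \<union> ?L"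
  proof
    fix x
    show "x \<in> A True \<union> A False \<union> ?L"
    proof (cases "x \<in> ?L")
      case False
      then have 0: "f 0 x \<notin> B" and "\<exists>k. k \<le> n \<and> f k x \<in> B" by auto
      then obtain k where k: "k \<le> n" "f k x \<in> B" "\<forall>j<k. \<not> (j \<le> n \<and> f j x \<in> B)"
        using exists_least_iff[of "\<lambda>k. k \<le> n \<and> f k x \<in> B"] by blast
      then have "k \<in> {1..n}" using 0 by (cases k) auto
      with k have "x \<in> A (even k)" unfolding A_def by force
      then show ?thesis by (cases "even k") auto
    qed auto
  qed
  then have "prob UNIV \<le> prob (A True \<union> A False \<union> ?L)"
    by (intro finite_measure_mono) simp_all
  also have "\<dots> \<le> prob (A True) + prob (A False) + prob ?L"
    by (intro order_trans[OF measure_Un_le] add_right_mono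
        measure_Un_le) simp_all
  finally have "1 \<le> prob (A True) + prob (A False) + 2 * \<epsilon>"
    using B q(2) n prob_space unfolding space_haar by linarith
  then have "prob (A True) \<ge> 1 / 2 - \<epsilon> \<or> prob (A False) \<ge> 1 / 2 - \<epsilon>" by linarith
  then show ?thesis using free A by blast
qed

end

section \<open>The value of the density\<close>

theorem proposition3p1:
  fixes \<mu> :: "'a::{topological_ab_group_add, polish_space} measure"
    and c1 c2 :: int
  assumes "compact (UNIV :: 'a set)"
    and "\<exists>x::'a. x \<noteq> 0"
    and "divisible_group TYPE('a)"
    and "haar_prob_measure \<mu>"
    and "c1 \<noteq> 0" and "c2 \<noteq> 0" and "c1 \<noteq> c2"
  shows "free_density c1 c2 \<mu> = 1 / 2"
proof -
  interpret prob_space \<mu> using assms(4) by (simp add: haar_prob_measure_def)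
  interpret divisible_haar \<mu> by unfold_locales fact+
  let ?F = "{A \<in> sets borel. pair_free c1 c2 A}"
  have upper: "prob A \<le> 1 / 2" if "A \<in> ?F" for A
    using pair_free_prob_le_half assms(5,6) that by blast
  \<comment> \<open>A real supremum is bounded by an upper bound only over a nonempty
    family.\<close>
  have "{} \<in> ?F" by (simp add: pair_free_def)
  then have "free_density c1 c2 \<mu> \<le> 1 / 2"
    unfolding free_density_def using upper by (intro cSUP_least) blast+
  moreover have "1 / 2 \<le> free_density c1 c2 \<mu> + \<epsilon>" if "\<epsilon> > 0" for \<epsilon>
  proof -
    obtain A where A: "A \<in> ?F" "1 / 2 - \<epsilon> \<le> prob A"
    proof (cases "\<bar>c1\<bar> = \<bar>c2\<bar>")
      case True
      then have "c2 = - c1" using assms(7) by linarith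
      then show ?thesis using pair_free_opposite[OF assms(5) \<open>\<epsilon> > 0\<close>] that by blast
    next
      case False
      then show ?thesis using pair_free_generic[OF assms(5,6) False \<open>\<epsilon> > 0\<close>] that by blast
    qed
    have "prob A \<le> free_density c1 c2 \<mu>"
      unfolding free_density_def using A(1) upper by (intro cSUP_upper bdd_aboveI2) blast+
    with A(2) show ?thesis by simp
  qed
  ultimately show ?thesis
    by (metis antisym field_le_epsilon)
qed

end
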